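(* Let $Z\sim\mathcal{W}_2(2,\tfrac12 I_2)$ and let $X=(X_1,X_2,X_3)^\top$ with $X_j=\mathrm{Tr}(H_jZ)$, $j=1,2,3$, where $$H_1=\begin{pmatrix}1&0\\0&1\end{pmatrix},\quad H_2=\begin{pmatrix}2&1\\1&2\end{pmatrix},\quad H_3=\begin{pmatrix}3&0\\0&1\end{pmatrix}.$$ Then the distribution of $X$ belongs to ${}_3\mathrm{MVPH}$.
   Context: $\mathcal{W}_2(2,\tfrac12 I_2)$ is the Wishart distribution on $2\times2$ symmetric positive semidefinite matrices with $2$ degrees of freedom and scale matrix $\tfrac12I_2$: $Z=\tfrac12(G_1G_1^\top+G_2G_2^\top)$ with $G_1,G_2$ independent standard Gaussian column vectors in $\mathbb{R}^2$. Equivalently, $Z$ has density $f_Z(z)=\pi^{-1}\det(z)^{-1/2}e^{-\mathrm{Tr}(z)}$ on positive definite $z=\begin{pmatrix} z_{11} & z_{12} \\ z_{12} & z_{22} \end{pmatrix}$ with respect to Lebesgue measure in $(z_{11},z_{22},z_{12})$; its transform is $\mathbb{E}[e^{-\mathrm{Tr}(BZ)}]=\det(I_2+B)^{-1}$ for every symmetric positive semidefinite $B$. A transient subgenerator is a matrix $T\in\mathbb{R}^{m\times m}$ with $T_{ii}<0$, $T_{ij}\ge0$ for $i\ne j$, $T\mathbf 1\le0$ componentwise, and such that the associated continuous-time Markov chain is transient, i.e. absorption is almost sure from every state (equivalently, $T$ is invertible); $\mathbf 1$ is the all-ones column vector. A non-negative random variable $W$ is phase-type ($W\in\mathrm{PH}$)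 if there exist $m\ge1$, a transient subgenerator $T\in\mathbb{R}^{m\times m}$ and a row vector $\alpha\ge0$ with $\alpha\mathbf 1\le1$ such that $\mathbb{E}[e^{-sW}]=p_0+\alpha(sI_m-T)^{-1}\mathbf t$ with $\mathbf t=-T\mathbf 1$ and $p_0=1-\alpha\mathbf 1$. The class ${}_n\mathrm{MVPH}$ consists of random vectors $Y$ in $\mathbb{R}_+^n=[0,\infty)^n$ such that $\langle a,Y\rangle=\sum_j a_jY_j\in\mathrm{PH}$ for every $a\in\mathbb{R}_+^n\setminus\{0\}$. *)

theory Defs
  imports
    "HOL-Probability.Probability"
    "Jordan_Normal_Form.Gauss_Jordan_Elimination"
    "Jordan_Normal_Form.Determinant"
begin

no_notation vec_index (infixl "$" 100)
no_notation scalar_prod (infix "\<bullet>" 70)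
no_notation mult_mat_vec (infixl "*\<^sub>v" 70)

definition std_gaussian :: "(real^'n) measure" where
  "std_gaussian =
     distr (\<Pi>\<^sub>M i\<in>UNIV. density lborel std_normal_density) borel (\<lambda>g. \<chi> i. g i)"

text \<open>The law of \<open>(G\<^sub>1 G\<^sub>1\<^sup>T + G\<^sub>2 G\<^sub>2\<^sup>T) / 2\<close> for independent standard Gaussian column
  vectors \<open>G\<^sub>1\<close>, \<open>G\<^sub>2\<close> in the plane, that is, the Wishart distribution with \<open>2\<close> degrees of
  freedom and scale matrix \<open>I\<^sub>2 / 2\<close>.\<close>

definition wishart_2_half :: "(real^2^2) measure" where
  "wishart_2_half =
     distr (std_gaussian \<Otimes>\<^sub>M std_gaussian) borel
       (\<lambda>(g1 :: real^2, g2 :: real^2). \<chi> i j. (g1 $ i * g1 $ j + g2 $ i * g2 $ j) / 2)"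

text \<open>The matrix \<open>T\<close> governs a continuous-time Markov chain on the states \<open>i < dim_row T\<close> together
  with an absorbing state: state \<open>i\<close> is held for an exponential time of rate \<open>- T\<^sub>i\<^sub>i\<close>, then the
  chain jumps to \<open>j \<noteq> i\<close> with probability \<open>T\<^sub>i\<^sub>j / (- T\<^sub>i\<^sub>i)\<close> and is absorbed with the remaining
  probability. The number \<open>not_absorbed T k i\<close> is the probability that the chain started in \<open>i\<close>
  is not absorbed by its first \<open>k\<close> jumps.\<close>

primrec not_absorbed :: "real mat \<Rightarrow> nat \<Rightarrow> nat \<Rightarrow> real" where
  "not_absorbed T 0 i = 1"
| "not_absorbed T (Suc k) i =
     (\<Sum>j\<in>{..<dim_row T} - {i}. T $$ (i, j) / (- T $$ (i, i)) * not_absorbed T k j)"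

definition subgenerator :: "nat \<Rightarrow> real mat \<Rightarrow> bool" where
  "subgenerator m T \<longleftrightarrow>
     T \<in> carrier_mat m m \<and>
     (\<forall>i<m. T $$ (i, i) < 0) \<and>
     (\<forall>i<m. \<forall>j<m. i \<noteq> j \<longrightarrow> T $$ (i, j) \<ge> 0) \<and>
     (\<forall>i<m. (\<Sum>j<m. T $$ (i, j)) \<le> 0)"

text \<open>Absorption is almost sure from every state. The lemma
  \<open>transient_subgenerator_iff_invertible\<close> below shows that this means invertibility of \<open>T\<close>.\<close>

definition transient_subgenerator :: "nat \<Rightarrow> real mat \<Rightarrow> bool" where
  "transient_subgenerator m T \<longleftrightarrow>
     subgenerator m T \<and> (\<forall>i<m. (\<lambda>k. not_absorbed T k i) \<longlonglongrightarrow> 0)"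

lemma invertible_mat_iff_det:
  fixes A :: "real mat"
  assumes A: "A \<in> carrier_mat m m"
  shows "invertible_mat A \<longleftrightarrow> Determinant.det A \<noteq> 0"
proof
  assume "invertible_mat A"
  then obtain B where AB: "A * B = 1\<^sub>m (dim_row A)" and BA: "B * A = 1\<^sub>m (dim_row B)"
    unfolding invertible_mat_def inverts_mat_def by blast
  have "dim_col B = dim_row A" using arg_cong[OF AB, of dim_col] by simp
  moreover have "dim_col A = dim_row B" using arg_cong[OF BA, of dim_col] by simp
  ultimately have B: "B \<in> carrier_mat m m"
    using carrier_matD[OF A] by (intro carrier_matI) simp_all
  have "Determinant.det A * Determinant.det B = Determinant.det (1\<^sub>m (dim_row A))"
    unfolding AB[symmetric] by (rule Determinant.det_mult[OF A B, symmetric])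
  then show "Determinant.det A \<noteq> 0" by auto
next
  assume "Determinant.det A \<noteq> 0"
  from det_non_zero_imp_unit[OF A this, of "()"] mat_inverse(1)[OF A, of "()"]
  obtain B where "mat_inverse A = Some B" by (cases "mat_inverse A") auto
  from mat_inverse(2)[OF A this]
  have "inverts_mat A B" "inverts_mat B A"
    using carrier_matD[OF A] unfolding inverts_mat_def by auto
  then show "invertible_mat A"
    unfolding invertible_mat_def using carrier_matD[OF A] by auto
qed

lemma invertible_mat_iff_kernel:
  fixes A :: "real mat"
  assumes A: "A \<in> carrier_mat m m"
  shows "invertible_mat A \<longleftrightarrow>
    (\<forall>v. (\<forall>i<m. (\<Sum>j<m. A $$ (i, j) * v j) = 0) \<longrightarrow> (\<forall>i<m. v i = 0))"
proof -
  let ?K = "\<lambda>w :: real Matrix.vec. mult_mat_vec A w = 0\<^sub>v m"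
  have mv: "vec_index (mult_mat_vec A w) i = (\<Sum>j<m. A $$ (i, j) * vec_index w j)"
    if "i < m" "w \<in> carrier_vec m" for w i
    using that A by (auto simp: scalar_prod_def lessThan_atLeast0 intro!: sum.cong)
  have K: "?K w \<longleftrightarrow> (\<forall>i<m. (\<Sum>j<m. A $$ (i, j) * vec_index w j) = 0)"
    if "w \<in> carrier_vec m" for w
  proof
    assume "?K w"
    then show "\<forall>i<m. (\<Sum>j<m. A $$ (i, j) * vec_index w j) = 0"
      using mv[OF _ that] by (metis index_zero_vec(1))
  next
    assume "\<forall>i<m. (\<Sum>j<m. A $$ (i, j) * vec_index w j) = 0"
    then show "?K w"
      using mv[OF _ that] A by (intro eq_vecI) auto
  qed
  have "invertible_mat A \<longleftrightarrow> Determinant.det A \<noteq> 0"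
    by (rule invertible_mat_iff_det[OF A])
  also have "\<dots> \<longleftrightarrow> (\<forall>w. w \<in> carrier_vec m \<longrightarrow> ?K w \<longrightarrow> w = 0\<^sub>v m)"
    using det_0_iff_vec_prod_zero_field[OF A] by blast
  also have "\<dots> \<longleftrightarrow>
    (\<forall>v. (\<forall>i<m. (\<Sum>j<m. A $$ (i, j) * v j) = 0) \<longrightarrow> (\<forall>i<m. v i = 0))"
  proof safe
    fix v i assume *: "\<forall>w. w \<in> carrier_vec m \<longrightarrow> ?K w \<longrightarrow> w = 0\<^sub>v m"
      "\<forall>i<m. (\<Sum>j<m. A $$ (i, j) * v j) = 0" "i < m"
    then have "Matrix.vec m v = 0\<^sub>v m" using K[of "Matrix.vec m v"] by simp
    then show "v i = 0" using \<open>i < m\<close> by (metis index_vec index_zero_vec(1))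
  next
    fix w assume *: "\<forall>v. (\<forall>i<m. (\<Sum>j<m. A $$ (i, j) * v j) = 0) \<longrightarrow> (\<forall>i<m. v i = 0)"
      "w \<in> carrier_vec m" "?K w"
    then have "\<forall>i<m. vec_index w i = 0" using K[of w] by blast
    then show "w = 0\<^sub>v m" using *(2) by (intro eq_vecI) auto
  qed
  finally show ?thesis .
qed

lemma resolvent_kernel:
  assumes sub: "subgenerator m T" and lim: "\<forall>i<m. (\<lambda>k. not_absorbed T k i) \<longlonglongrightarrow> 0"
    and s: "s \<ge> 0" and v: "\<forall>i<m. (\<Sum>j<m. T $$ (i, j) * v j) = s * v i"
  shows "\<forall>i<m. v i = 0"
proof -
  note T = sub[unfolded subgenerator_def]
  have carrier: "T \<in> carrier_mat m m" by (rule T[THEN conjunct1])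
  then have dim: "dim_row T = m" by (rule carrier_matD)
  define c where "c = (\<Sum>j<m. \<bar>v j\<bar>)"
  have bound: "\<forall>i<m. \<bar>v i\<bar> \<le> c * not_absorbed T k i" for k
  proof (induction k)
    case 0
    have "\<bar>v i\<bar> \<le> c" if "i < m" for i
      unfolding c_def using that by (intro member_le_sum) auto
    then show ?case by simp
  next
    case (Suc k)
    show ?case
    proof (intro allI impI)
      fix i assume i: "i < m"
      have d: "T $$ (i, i) < 0" using T i by blast
      have "s * v i = (\<Sum>j<m. T $$ (i, j) * v j)"
        using v[rule_format, OF i] by (rule sym)
      also have "\<dots> = T $$ (i, i) * v i + (\<Sum>j\<in>{..<m} - {i}. T $$ (i, j) * v j)"
        by (rule sum.remove) (use i in auto)
      finally have eq: "(s - T $$ (i, i)) * v i = (\<Sum>j\<in>{..<m} - {i}. T $$ (i, j) * v j)"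
        by (simp add: algebra_simps)
      have "(- T $$ (i, i)) * \<bar>v i\<bar> \<le> (s - T $$ (i, i)) * \<bar>v i\<bar>"
        using s by (intro mult_right_mono) auto
      also have "\<dots> = \<bar>(s - T $$ (i, i)) * v i\<bar>"
        using s d by (simp add: abs_mult)
      also have "\<dots> \<le> (\<Sum>j\<in>{..<m} - {i}. \<bar>T $$ (i, j) * v j\<bar>)"
        unfolding eq by (rule sum_abs)
      also have "\<dots> \<le> (\<Sum>j\<in>{..<m} - {i}. T $$ (i, j) * (c * not_absorbed T k j))"
      proof (rule sum_mono)
        fix j assume j: "j \<in> {..<m} - {i}"
        then have "0 \<le> T $$ (i, j)" "\<bar>v j\<bar> \<le> c * not_absorbed T k j"
          using T i Suc by blast+
        then show "\<bar>T $$ (i, j) * v j\<bar> \<le> T $$ (i, j) * (c * not_absorbed T k j)"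
          unfolding abs_mult by (simp add: mult_left_mono)
      qed
      finally have "\<bar>v i\<bar> \<le>
          (\<Sum>j\<in>{..<m} - {i}. T $$ (i, j) * (c * not_absorbed T k j)) / (- T $$ (i, i))"
        using d by (subst pos_le_divide_eq) (simp_all add: mult.commute)
      also have "\<dots> = c * not_absorbed T (Suc k) i"
        unfolding not_absorbed.simps dim sum_divide_distrib sum_distrib_left
        by (intro sum.cong refl) simp
      finally show "\<bar>v i\<bar> \<le> c * not_absorbed T (Suc k) i" .
    qed
  qed
  show ?thesis
  proof (intro allI impI)
    fix i assume i: "i < m"
    have "(\<lambda>k. c * not_absorbed T k i) \<longlonglongrightarrow> c * 0"
      using lim i by (intro tendsto_mult_left) auto
    then have "\<bar>v i\<bar> \<le> c * 0"
      by (rule LIMSEQ_le_const) (use bound i in auto)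
    then show "v i = 0" by simp
  qed
qed

lemma transient_subgenerator_iff_invertible:
  "transient_subgenerator m T \<longleftrightarrow> subgenerator m T \<and> invertible_mat T"
proof (cases "subgenerator m T")
  case sub: True
  note T = sub[unfolded subgenerator_def]
  have carrier: "T \<in> carrier_mat m m" by (rule T[THEN conjunct1])
  then have dim: "dim_row T = m" by (rule carrier_matD)
  show ?thesis
  proof safe
    assume "transient_subgenerator m T"
    then have lim: "\<forall>i<m. (\<lambda>k. not_absorbed T k i) \<longlonglongrightarrow> 0"
      by (simp add: transient_subgenerator_def)
    show "invertible_mat T"
      unfolding invertible_mat_iff_kernel[OF carrier]
      using resolvent_kernel[OF sub lim, of 0] by auto
  next
    assume inv: "invertible_mat T"
    have nonneg: "\<forall>i<m. 0 \<le> not_absorbed T k i" for k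
    proof (induction k)
      case (Suc k)
      show ?case
      proof (intro allI impI)
        fix i assume "i < m"
        moreover from this have "T $$ (i, i) < 0" using T by blast
        ultimately show "0 \<le> not_absorbed T (Suc k) i"
          unfolding not_absorbed.simps dim using T Suc
          by (intro sum_nonneg mult_nonneg_nonneg divide_nonneg_pos) auto
      qed
    qed auto
    have decr: "\<forall>i<m. not_absorbed T (Suc k) i \<le> not_absorbed T k i" for k
    proof (induction k)
      case 0
      show ?case
      proof (intro allI impI)
        fix i assume i: "i < m"
        then have d: "T $$ (i, i) < 0" and "(\<Sum>j<m. T $$ (i, j)) \<le> 0" using T by auto
        then have "(\<Sum>j\<in>{..<m} - {i}. T $$ (i, j)) \<le> - T $$ (i, i)"
          using i by (simp add: sum.remove[of "{..<m}" i])
        then have "(\<Sum>j\<in>{..<m} - {i}. T $$ (i, j)) / (- T $$ (i, i)) \<le> 1"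
          using d by (subst pos_divide_le_eq) auto
        then show "not_absorbed T (Suc 0) i \<le> not_absorbed T 0 i"
          by (simp add: dim sum_divide_distrib sum_negf)
      qed
    next
      case (Suc k)
      show ?case
      proof (intro allI impI)
        fix i assume i: "i < m"
        moreover from this have "T $$ (i, i) < 0" using T by blast
        ultimately show "not_absorbed T (Suc (Suc k)) i \<le> not_absorbed T (Suc k) i"
          using T Suc
          by (subst (1 2) not_absorbed.simps(2), unfold dim)
             (intro sum_mono mult_left_mono divide_nonneg_pos, auto simp del: not_absorbed.simps)
      qed
    qed
    have "\<exists>u. (\<lambda>k. not_absorbed T k i) \<longlonglongrightarrow> u" if "i < m" for i
    proof -
      have "decseq (\<lambda>k. not_absorbed T k i)"
        unfolding decseq_Suc_iff using decr that by blast
      then show ?thesis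
        using decseq_convergent[of "\<lambda>k. not_absorbed T k i" 0] nonneg that by metis
    qed
    then obtain u where u: "(\<lambda>k. not_absorbed T k i) \<longlonglongrightarrow> u i" if "i < m" for i
      by metis
    have "(\<Sum>j<m. T $$ (i, j) * u j) = 0" if i: "i < m" for i
    proof -
      have d: "T $$ (i, i) < 0" using T i by blast
      have "(\<lambda>k. not_absorbed T (Suc k) i) \<longlonglongrightarrow>
          (\<Sum>j\<in>{..<m} - {i}. T $$ (i, j) / (- T $$ (i, i)) * u j)"
        unfolding not_absorbed.simps dim by (intro tendsto_sum tendsto_mult_left u) auto
      then have "u i = (\<Sum>j\<in>{..<m} - {i}. T $$ (i, j) / (- T $$ (i, i)) * u j)"
        using LIMSEQ_Suc[OF u[OF i]] LIMSEQ_unique by blast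
      also have "\<dots> = (\<Sum>j\<in>{..<m} - {i}. T $$ (i, j) * u j) / (- T $$ (i, i))"
        by (simp add: sum_divide_distrib sum_negf)
      finally have "T $$ (i, i) * u i = - (\<Sum>j\<in>{..<m} - {i}. T $$ (i, j) * u j)"
        using d by (simp add: field_simps)
      then show ?thesis using i by (simp add: sum.remove[of "{..<m}" i])
    qed
    then have "\<forall>i<m. u i = 0"
      using inv unfolding invertible_mat_iff_kernel[OF carrier] by blast
    then show "transient_subgenerator m T"
      using u sub by (auto simp: transient_subgenerator_def)
  qed (use sub in auto)
qed (auto simp: transient_subgenerator_def)

lemma mat_inverse_resolvent:
  assumes T: "transient_subgenerator m T" and s: "s \<ge> 0"
  obtains B where "mat_inverse (s \<cdot>\<^sub>m 1\<^sub>m m - T) = Some B" "B \<in> carrier_mat m m"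
    "(s \<cdot>\<^sub>m 1\<^sub>m m - T) * B = 1\<^sub>m m" "B * (s \<cdot>\<^sub>m 1\<^sub>m m - T) = 1\<^sub>m m"
proof -
  let ?A = "s \<cdot>\<^sub>m 1\<^sub>m m - T"
  have sub: "subgenerator m T" and lim: "\<forall>i<m. (\<lambda>k. not_absorbed T k i) \<longlonglongrightarrow> 0"
    using T unfolding transient_subgenerator_def by blast+
  have carrier: "T \<in> carrier_mat m m" using sub unfolding subgenerator_def by (rule conjunct1)
  have A: "?A \<in> carrier_mat m m" using carrier by auto
  have eq: "(\<Sum>j<m. ?A $$ (i, j) * v j) = s * v i - (\<Sum>j<m. T $$ (i, j) * v j)"
    if "i < m" for v :: "nat \<Rightarrow> real" and i
  proof -
    have "(\<Sum>j<m. ?A $$ (i, j) * v j) =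
        (\<Sum>j<m. (if j = i then s * v i else 0) - T $$ (i, j) * v j)"
      using that carrier by (intro sum.cong) (auto simp: algebra_simps)
    then show ?thesis using that by (simp add: sum_subtractf)
  qed
  have "invertible_mat ?A"
    unfolding invertible_mat_iff_kernel[OF A]
  proof (rule allI, rule impI)
    fix v assume v: "\<forall>i<m. (\<Sum>j<m. ?A $$ (i, j) * v j) = 0"
    have "\<forall>i<m. (\<Sum>j<m. T $$ (i, j) * v j) = s * v i"
    proof (intro allI impI)
      fix i assume i: "i < m"
      show "(\<Sum>j<m. T $$ (i, j) * v j) = s * v i"
        using eq[OF i, of v] v[rule_format, OF i] by linarith
    qed
    then show "\<forall>i<m. v i = 0" by (rule resolvent_kernel[OF sub lim s])
  qed
  then have "?A \<in> Units (ring_mat TYPE(real) m ())"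
    using det_non_zero_imp_unit[OF A] by (simp add: invertible_mat_iff_det[OF A])
  then obtain C where C: "mat_inverse ?A = Some C"
    using mat_inverse(1)[OF A, of "()"] by (cases "mat_inverse ?A") auto
  show thesis by (rule that[OF C]) (use mat_inverse(2)[OF A C] in simp_all)
qed

lemma prob_space_std_gaussian: "prob_space (std_gaussian :: (real^'n) measure)"
proof -
  interpret N: prob_space "density lborel std_normal_density"
    by (rule prob_space_normal_density) simp
  interpret P: product_prob_space "\<lambda>_::'n. density lborel std_normal_density" UNIV ..
  have "(\<lambda>g. \<chi> i. g i) \<in> (\<Pi>\<^sub>M i\<in>(UNIV::'n set). density lborel std_normal_density) \<rightarrow>\<^sub>M borel"
    unfolding borel_measurable_euclidean_space[where 'c = "real^'n"]
    by (auto simp: Basis_vec_def inner_axis)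
  then show ?thesis
    unfolding std_gaussian_def by (rule P.prob_space_distr)
qed

lemma prob_space_wishart_2_half: "prob_space wishart_2_half"
proof -
  interpret G: prob_space "std_gaussian :: (real^2) measure"
    by (rule prob_space_std_gaussian)
  interpret P: pair_prob_space "std_gaussian :: (real^2) measure" "std_gaussian :: (real^2) measure" ..
  have [measurable_cong]: "sets (std_gaussian :: (real^2) measure) = sets borel"
    by (simp add: std_gaussian_def)
  have [measurable]: "(\<lambda>g :: real^2. g $ i) \<in> borel_measurable borel" for i
    by (intro borel_measurable_continuous_onI continuous_intros)
  have "(\<lambda>(g1 :: real^2, g2 :: real^2). (\<chi> i j. (g1 $ i * g1 $ j + g2 $ i * g2 $ j) / 2) :: real^2^2)
      \<in> std_gaussian \<Otimes>\<^sub>M std_gaussian \<rightarrow>\<^sub>M borel"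
    unfolding borel_measurable_euclidean_space[where 'c = "real^2^2"]
    by (auto simp: Basis_vec_def inner_axis case_prod_unfold)
  then show ?thesis
    unfolding wishart_2_half_def by (rule P.prob_space_distr)
qed

abbreviation ones :: "nat \<Rightarrow> real Matrix.vec" where
  "ones m \<equiv> Matrix.vec m (\<lambda>_. 1)"

text \<open>The function \<open>\<lambda>s. p\<^sub>0 + \<alpha> (s I\<^sub>m - T)\<^sup>-\<^sup>1 \<t>\<close> with \<open>\<t> = - T \<one>\<close> and \<open>p\<^sub>0 = 1 - \<alpha> \<one>\<close>. For a
  transient subgenerator and \<open>s \<ge> 0\<close> the inverse exists, see \<open>mat_inverse_resolvent\<close> above.\<close>

definition ph_transform :: "nat \<Rightarrow> real Matrix.vec \<Rightarrow> real mat \<Rightarrow> real \<Rightarrow> real" where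
  "ph_transform m \<alpha> T s =
     (1 - scalar_prod \<alpha> (ones m)) +
     scalar_prod \<alpha>
       (mult_mat_vec (the (mat_inverse (s \<cdot>\<^sub>m 1\<^sub>m m - T))) (- mult_mat_vec T (ones m)))"

definition PH :: "real measure set" where
  "PH = {\<mu>. prob_space \<mu> \<and> sets \<mu> = sets borel \<and> (AE w in \<mu>. 0 \<le> w) \<and>
     (\<exists>m T \<alpha>. m \<ge> 1 \<and> transient_subgenerator m T \<and>
        \<alpha> \<in> carrier_vec m \<and> (\<forall>i<m. vec_index \<alpha> i \<ge> 0) \<and> scalar_prod \<alpha> (ones m) \<le> 1 \<and>
        (\<forall>s\<ge>0. (\<integral>w. exp (- s * w) \<partial>\<mu>) = ph_transform m \<alpha> T s))}"

definition MVPH :: "(real^'n) measure set" where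
  "MVPH = {\<mu>. prob_space \<mu> \<and> sets \<mu> = sets borel \<and> (AE y in \<mu>. \<forall>j. 0 \<le> y $ j) \<and>
     (\<forall>a. (\<forall>j. 0 \<le> a $ j) \<and> a \<noteq> 0 \<longrightarrow> distr \<mu> borel (\<lambda>y. a \<bullet> y) \<in> PH)}"

end

theory Submission
  imports Defs
begin

text \<open>
  For \<open>a \<ge> 0\<close> the functional \<open>\<langle>a, X\<rangle>\<close> is \<open>Tr(A Z)\<close> with \<open>A = a\<^sub>1 H\<^sub>1 + a\<^sub>2 H\<^sub>2 + a\<^sub>3 H\<^sub>3\<close>. Each
  \<open>H\<^sub>j\<close> is positive definite, so \<open>A\<close> is positive definite unless \<open>a = 0\<close>. It therefore suffices to
  show that \<open>Tr(A Z)\<close> is phase-type for every positive definite \<open>A\<close>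
  (\<open>trace_wishart_2_half_PH\<close>).

  Since \<open>Tr(B Z) = \<langle>G\<^sub>1, B G\<^sub>1\<rangle> / 2 + \<langle>G\<^sub>2, B G\<^sub>2\<rangle> / 2\<close>, the Laplace transform of \<open>Z\<close> at \<open>B\<close> is the
  square of a Gaussian integral equal to \<open>det(I + B)\<^bsup>-1/2\<^esup>\<close>; two degrees of freedom thus give
  exactly \<open>1 / det(I + B)\<close> (\<open>wishart_2_half_transform\<close>), a rational function. If \<open>l, m > 0\<close> are the
  eigenvalues of \<open>A\<close>, then at \<open>B = s A\<close> it equals \<open>1 / ((1 + s l) (1 + s m))\<close>. This is the
  transform of a sum of two independent exponential variables with rates \<open>1 / l\<close> and \<open>1 / m\<close>,
  that is, of the absorption time of a chain that passes through two states in succession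
  (\<open>ph_transform_hypoexp\<close>).
\<close>

section \<open>Gaussian integrals\<close>

text \<open>Completing the square turns the integrand into a multiple of the density of the normal
  distribution with mean \<open>- b / (1 + p)\<close> and variance \<open>1 / (1 + p)\<close>. The linear term is kept because
  the mixed term of a quadratic form in two variables is linear in each of them.\<close>

lemma nn_integral_std_normal_exp_quadratic:
  fixes p b :: real
  assumes p: "0 < 1 + p"
  shows "(\<integral>\<^sup>+x. ennreal (exp (- (p * x\<^sup>2 / 2 + b * x))) \<partial>density lborel std_normal_density) =
    ennreal (exp (b\<^sup>2 / (2 * (1 + p))) / sqrt (1 + p))"
proof -
  let ?N = "normal_density (- b / (1 + p)) (1 / sqrt (1 + p))"
  let ?K = "exp (b\<^sup>2 / (2 * (1 + p))) / sqrt (1 + p)"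
  interpret N: prob_space "density lborel ?N"
    by (rule prob_space_normal_density) (use p in simp)
  have square: "- x\<^sup>2 / 2 + - (p * x\<^sup>2 / 2 + b * x) =
      b\<^sup>2 / (2 * (1 + p)) + - ((1 + p) * (x - (- b / (1 + p)))\<^sup>2 / 2)" for x
  proof -
    obtain c where c: "p = c - 1" "c \<noteq> 0" using p that[of "1 + p"] by auto
    then show ?thesis unfolding c(1) by (simp add: field_simps power2_eq_square)
  qed
  have N: "?N x = sqrt (1 + p) / sqrt (2 * pi) * exp (- ((1 + p) * (x - (- b / (1 + p)))\<^sup>2 / 2))" for x
    using p by (simp add: normal_density_def power_divide real_sqrt_divide)
  have pointwise: "std_normal_density x * exp (- (p * x\<^sup>2 / 2 + b * x)) = ?K * ?N x" for x
  proof -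
    have "std_normal_density x * exp (- (p * x\<^sup>2 / 2 + b * x)) =
        1 / sqrt (2 * pi) * exp (- x\<^sup>2 / 2 + - (p * x\<^sup>2 / 2 + b * x))"
      by (simp only: std_normal_density_def exp_add mult.assoc)
    also have "\<dots> = ?K * ?N x"
      unfolding square N exp_add using p by simp
    finally show ?thesis .
  qed
  have "(\<integral>\<^sup>+x. ennreal (exp (- (p * x\<^sup>2 / 2 + b * x))) \<partial>density lborel std_normal_density) =
      (\<integral>\<^sup>+x. ennreal (std_normal_density x * exp (- (p * x\<^sup>2 / 2 + b * x))) \<partial>lborel)"
    by (subst nn_integral_density) (auto simp: ennreal_mult)
  also have "\<dots> = (\<integral>\<^sup>+x. ennreal ?K * ennreal (?N x) \<partial>lborel)"
    unfolding pointwise using p by (intro nn_integral_cong ennreal_mult) auto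
  also have "\<dots> = ennreal ?K * (\<integral>\<^sup>+x. ennreal (?N x) \<partial>lborel)"
    by (rule nn_integral_cmult) simp
  also have "(\<integral>\<^sup>+x. ennreal (?N x) \<partial>lborel) = 1"
    using N.emeasure_space_1 by (simp add: emeasure_density)
  finally show ?thesis by simp
qed

lemma sets_std_gaussian [measurable_cong]: "sets (std_gaussian :: (real^'n) measure) = sets borel"
  by (simp add: std_gaussian_def)

lemma measurable_vec_nth [measurable]: "(\<lambda>g :: real^'n. g $ i) \<in> borel_measurable borel"
  by (intro borel_measurable_continuous_onI continuous_intros)

lemma measurable_exp_quadratic [measurable]:
  "(\<lambda>g :: real^'n. exp (- (g \<bullet> (B *v g) / 2))) \<in> borel_measurable borel"
  by (intro borel_measurable_continuous_onI continuous_intros) auto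

lemma nn_integral_std_gaussian_2:
  fixes f :: "real^2 \<Rightarrow> ennreal"
  assumes [measurable]: "f \<in> borel_measurable borel"
  shows "integral\<^sup>N std_gaussian f =
    (\<integral>\<^sup>+y. \<integral>\<^sup>+x. f (vector [x, y]) \<partial>density lborel std_normal_density
      \<partial>density lborel std_normal_density)"
proof -
  let ?N = "density lborel std_normal_density"
  interpret N: prob_space ?N
    by (rule prob_space_normal_density) simp
  interpret P: product_prob_space "\<lambda>_::2. ?N" UNIV ..
  have [measurable]: "(\<lambda>g. (\<chi> i. g i) :: real^2) \<in> (\<Pi>\<^sub>M i\<in>UNIV. ?N) \<rightarrow>\<^sub>M borel"
    unfolding borel_measurable_euclidean_space[where 'c = "real^2"]
    by (auto simp: Basis_vec_def inner_axis)
  \<comment> \<open>Splitting off the index \<open>1\<close> makes the first coordinate the inner integration variable.\<close>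
  have UNIV: "(UNIV :: 2 set) = insert 1 {2}" by (simp add: UNIV_2)
  have vec: "((\<chi> i. (g(1 := x)) i) :: real^2) = vector [x, g 2]" for g :: "2 \<Rightarrow> real" and x
    by (simp add: Finite_Cartesian_Product.vec_eq_iff forall_2)
  have [measurable]: "(\<lambda>(x, y). vector [x, y] :: real^2) \<in> borel \<Otimes>\<^sub>M borel \<rightarrow>\<^sub>M borel"
    unfolding borel_measurable_euclidean_space[where 'c = "real^2"]
    by (auto simp: Basis_vec_def inner_axis forall_2 case_prod_unfold)
  have "integral\<^sup>N std_gaussian f = (\<integral>\<^sup>+g. f (\<chi> i. g i) \<partial>(\<Pi>\<^sub>M i\<in>UNIV. ?N))"
    unfolding std_gaussian_def by (rule nn_integral_distr) measurable
  also have "\<dots> = (\<integral>\<^sup>+g. \<integral>\<^sup>+x. f (\<chi> i. (g(1 := x)) i) \<partial>?N \<partial>(\<Pi>\<^sub>M i\<in>{2}. ?N))"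
    unfolding UNIV by (rule P.product_nn_integral_insert) (auto simp flip: UNIV)
  also have "\<dots> = (\<integral>\<^sup>+y. \<integral>\<^sup>+x. f (vector [x, y]) \<partial>?N \<partial>?N)"
    unfolding vec by (rule P.product_nn_integral_singleton) measurable
  finally show ?thesis .
qed

text \<open>Integrating out the first coordinate replaces the coefficient \<open>r\<close> of \<open>y\<^sup>2\<close> by \<open>r'\<close>, where
  \<open>1 + r'\<close> is the Schur complement of the entry \<open>1 + p\<close> in \<open>I + B\<close>. The two one-dimensional factors
  multiply to the determinant because \<open>(1 + p) (1 + r') = det(I + B)\<close>.\<close>

lemma nn_integral_std_gaussian_exp_quadratic:
  fixes B :: "real^2^2"
  assumes sym: "B $ 2 $ 1 = B $ 1 $ 2" and p: "0 < 1 + B $ 1 $ 1"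
    and det: "0 < Determinants.det (Finite_Cartesian_Product.mat 1 + B)"
  shows "(\<integral>\<^sup>+g. ennreal (exp (- (g \<bullet> (B *v g) / 2))) \<partial>std_gaussian) =
    ennreal (1 / sqrt (Determinants.det (Finite_Cartesian_Product.mat 1 + B)))"
proof -
  let ?N = "density lborel std_normal_density"
  define p q r where "p = B $ 1 $ 1" and "q = B $ 1 $ 2" and "r = B $ 2 $ 2"
  define r' where "r' = r - q\<^sup>2 / (1 + p)"
  have p0: "0 < 1 + p" using p by (simp add: p_def)
  have det_eq: "Determinants.det (Finite_Cartesian_Product.mat 1 + B) = (1 + p) * (1 + r')"
    using p0 unfolding det_2 r'_def
    by (simp add: Finite_Cartesian_Product.mat_def sym p_def[symmetric] q_def[symmetric] r_def[symmetric]
        field_simps power2_eq_square)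
  have r0: "0 < 1 + r'"
    using det p0 unfolding det_eq by (simp add: zero_less_mult_iff)
  have quad: "vector [x, y] \<bullet> (B *v vector [x, y]) = p * x\<^sup>2 + 2 * q * x * y + r * y\<^sup>2" for x y :: real
    by (simp add: inner_vec_def matrix_vector_mult_def sum_2 sym p_def q_def r_def
        algebra_simps power2_eq_square)
  have "(\<integral>\<^sup>+g. ennreal (exp (- (g \<bullet> (B *v g) / 2))) \<partial>std_gaussian) =
      (\<integral>\<^sup>+y. \<integral>\<^sup>+x. ennreal (exp (- (r * y\<^sup>2 / 2))) *
        ennreal (exp (- (p * x\<^sup>2 / 2 + (q * y) * x))) \<partial>?N \<partial>?N)"
    by (subst nn_integral_std_gaussian_2)
       (auto intro!: nn_integral_cong
        simp: quad add_divide_distrib mult_ac simp flip: ennreal_mult exp_add)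
  also have "\<dots> = (\<integral>\<^sup>+y. ennreal (exp (- (r * y\<^sup>2 / 2))) *
        ennreal (exp ((q * y)\<^sup>2 / (2 * (1 + p))) / sqrt (1 + p)) \<partial>?N)"
    by (subst nn_integral_cmult) (simp, simp only: nn_integral_std_normal_exp_quadratic[OF p0])
  also have "\<dots> = (\<integral>\<^sup>+y. ennreal (1 / sqrt (1 + p)) *
        ennreal (exp (- (r' * y\<^sup>2 / 2 + 0 * y))) \<partial>?N)"
  proof (rule nn_integral_cong)
    fix y
    have exponent: "- (r' * y\<^sup>2 / 2 + 0 * y) = - (r * y\<^sup>2 / 2) + (q * y)\<^sup>2 / (2 * (1 + p))"
      using p0 by (simp add: r'_def field_simps power2_eq_square)
    show "ennreal (exp (- (r * y\<^sup>2 / 2))) * ennreal (exp ((q * y)\<^sup>2 / (2 * (1 + p))) / sqrt (1 + p)) =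
        ennreal (1 / sqrt (1 + p)) * ennreal (exp (- (r' * y\<^sup>2 / 2 + 0 * y)))"
      unfolding exponent exp_add using p0 by (simp flip: ennreal_mult)
  qed
  also have "\<dots> = ennreal (1 / sqrt (1 + p)) * ennreal (1 / sqrt (1 + r'))"
    by (subst nn_integral_cmult, simp, subst nn_integral_std_normal_exp_quadratic[OF r0]) simp
  also have "\<dots> = ennreal (1 / sqrt (Determinants.det (Finite_Cartesian_Product.mat 1 + B)))"
    unfolding det_eq using p0 r0 by (simp add: real_sqrt_mult flip: ennreal_mult)
  finally show ?thesis .
qed

section \<open>The Wishart distribution\<close>

lemma sets_wishart_2_half [measurable_cong]: "sets wishart_2_half = sets borel"
  by (simp add: wishart_2_half_def)

lemma measurable_wishart_map [measurable]:
  "(\<lambda>(g1 :: real^2, g2 :: real^2). (\<chi> i j. (g1 $ i * g1 $ j + g2 $ i * g2 $ j) / 2) :: real^2^2)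
    \<in> std_gaussian \<Otimes>\<^sub>M std_gaussian \<rightarrow>\<^sub>M borel"
  unfolding borel_measurable_euclidean_space[where 'c = "real^2^2"]
  by (auto simp: Basis_vec_def inner_axis case_prod_unfold)

lemma trace_mult_wishart_map:
  fixes B :: "real^'n^'n" and g1 g2 :: "real^'n"
  shows "trace (B ** (\<chi> i j. (g1 $ i * g1 $ j + g2 $ i * g2 $ j) / 2)) =
    g1 \<bullet> (B *v g1) / 2 + g2 \<bullet> (B *v g2) / 2"
  by (simp add: trace_def matrix_matrix_mult_def inner_vec_def matrix_vector_mult_def
      sum_distrib_left sum_divide_distrib add_divide_distrib distrib_left sum.distrib mult_ac)

lemma measurable_trace_mult [measurable]:
  "(\<lambda>z :: real^'n^'n. trace (B ** z)) \<in> borel_measurable borel"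
  unfolding trace_def matrix_matrix_mult_def
  by (intro borel_measurable_continuous_onI) (auto intro!: continuous_intros)

text \<open>The two independent Gaussian vectors contribute one factor \<open>det(I + B)\<^bsup>-1/2\<^esup>\<close> each, so the
  square root disappears. The hypotheses say that the symmetric matrix \<open>I + B\<close> is positive definite,
  by the leading principal minors.\<close>

lemma wishart_2_half_transform:
  fixes B :: "real^2^2"
  assumes sym: "B $ 2 $ 1 = B $ 1 $ 2" and p: "0 < 1 + B $ 1 $ 1"
    and det: "0 < Determinants.det (Finite_Cartesian_Product.mat 1 + B)"
  shows "(\<integral>z. exp (- trace (B ** z)) \<partial>wishart_2_half) =
    1 / Determinants.det (Finite_Cartesian_Product.mat 1 + B)"
proof -
  let ?G = "std_gaussian :: (real^2) measure"
  let ?D = "Determinants.det (Finite_Cartesian_Product.mat 1 + B)"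
  let ?e = "\<lambda>g. ennreal (exp (- (g \<bullet> (B *v g) / 2)))"
  interpret G: prob_space ?G by (rule prob_space_std_gaussian)
  interpret P: pair_prob_space ?G ?G ..
  have "(\<integral>\<^sup>+z. ennreal (exp (- trace (B ** z))) \<partial>wishart_2_half) =
      (\<integral>\<^sup>+h. ?e (fst h) * ?e (snd h) \<partial>(?G \<Otimes>\<^sub>M ?G))"
    unfolding wishart_2_half_def
    by (subst nn_integral_distr)
       (auto intro!: nn_integral_cong simp: trace_mult_wishart_map case_prod_unfold
        simp flip: ennreal_mult exp_add)
  also have "\<dots> = (\<integral>\<^sup>+g1. \<integral>\<^sup>+g2. ?e g1 * ?e g2 \<partial>?G \<partial>?G)"
    by (subst G.nn_integral_fst[symmetric]) auto
  also have "\<dots> = ennreal (1 / sqrt ?D) * ennreal (1 / sqrt ?D)"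
    by (subst nn_integral_cmult, measurable, subst nn_integral_multc, measurable)
       (simp add: nn_integral_std_gaussian_exp_quadratic[OF sym p det])
  also have "\<dots> = ennreal (1 / ?D)"
    using det by (simp flip: ennreal_mult)
  finally show ?thesis
    using det by (subst integral_eq_nn_integral) auto
qed

lemma AE_wishart_2_half_trace_nonneg:
  fixes B :: "real^2^2"
  assumes psd: "\<And>g. 0 \<le> g \<bullet> (B *v g)"
  shows "AE z in wishart_2_half. 0 \<le> trace (B ** z)"
  unfolding wishart_2_half_def
  by (subst AE_distr_iff) (auto simp: trace_mult_wishart_map case_prod_unfold psd)

section \<open>Sums of two exponential variables\<close>

text \<open>The chain moves from the first state to the second at rate \<open>a\<close> and is absorbed from there at
  rate \<open>b\<close>.\<close>

definition hypoexp_generator :: "real \<Rightarrow> real \<Rightarrow> real mat" where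
  "hypoexp_generator a b = mat_of_rows_list 2 [[- a, a], [0, - b]]"

lemma hypoexp_generator_simps [simp]:
  "hypoexp_generator a b \<in> carrier_mat 2 2"
  "dim_row (hypoexp_generator a b) = 2"
  "dim_col (hypoexp_generator a b) = 2"
  "hypoexp_generator a b $$ (0, 0) = - a"
  "hypoexp_generator a b $$ (0, Suc 0) = a"
  "hypoexp_generator a b $$ (Suc 0, 0) = 0"
  "hypoexp_generator a b $$ (Suc 0, Suc 0) = - b"
  by (auto simp: hypoexp_generator_def mat_of_rows_list_def)

lemma all_less_2: "(\<forall>i<2::nat. P i) \<longleftrightarrow> P 0 \<and> P (Suc 0)"
  by (auto simp: numeral_2_eq_2 less_Suc_eq)

lemma sum_lessThan_2: "(\<Sum>i<2::nat. f i) = f 0 + f (Suc 0)"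
  by (simp add: numeral_2_eq_2)

lemma transient_subgenerator_hypoexp:
  assumes "0 < a" "0 < b"
  shows "transient_subgenerator 2 (hypoexp_generator a b)"
proof -
  have "subgenerator 2 (hypoexp_generator a b)"
    using assms by (simp add: subgenerator_def all_less_2 sum_lessThan_2)
  moreover have "invertible_mat (hypoexp_generator a b)"
    using assms by (subst invertible_mat_iff_kernel[of _ 2]) (auto simp: all_less_2 sum_lessThan_2)
  ultimately show ?thesis
    by (simp add: transient_subgenerator_iff_invertible)
qed

text \<open>The vector \<open>v = (s I - T)\<^sup>-\<^sup>1 \<t>\<close> solves the triangular system \<open>(s + a) v\<^sub>0 = a v\<^sub>1\<close>,
  \<open>(s + b) v\<^sub>1 = b\<close>, and starting in the first state picks out \<open>v\<^sub>0\<close>.\<close>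

lemma ph_transform_hypoexp:
  assumes a: "0 < a" and b: "0 < b" and s: "0 \<le> s"
  shows "ph_transform 2 (unit_vec 2 0) (hypoexp_generator a b) s = a * b / ((s + a) * (s + b))"
proof -
  let ?T = "hypoexp_generator a b"
  let ?A = "s \<cdot>\<^sub>m 1\<^sub>m 2 - ?T"
  let ?t = "- mult_mat_vec ?T (ones 2)"
  obtain B where B: "mat_inverse ?A = Some B" "B \<in> carrier_mat 2 2" "?A * B = 1\<^sub>m 2"
    using mat_inverse_resolvent[OF transient_subgenerator_hypoexp[OF a b] s] by metis
  define v where "v = mult_mat_vec B ?t"
  have t: "?t \<in> carrier_vec 2" by (auto intro!: uminus_carrier_vec mult_mat_vec_carrier[of _ _ 2])
  have v: "v \<in> carrier_vec 2" unfolding v_def using B(2) t by (rule mult_mat_vec_carrier)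
  have A: "?A \<in> carrier_mat 2 2" by auto
  have "mult_mat_vec ?A v = mult_mat_vec (?A * B) ?t"
    unfolding v_def by (rule assoc_mult_mat_vec[symmetric, OF A B(2) t])
  then have Av: "mult_mat_vec ?A v = ?t"
    using t by (simp add: B(3))
  have "(s + a) * vec_index v 0 - a * vec_index v 1 = 0"
    using arg_cong[OF Av, of "\<lambda>w. vec_index w 0"] v
    by (simp add: scalar_prod_def numeral_2_eq_2 algebra_simps)
  moreover have "(s + b) * vec_index v 1 = b"
    using arg_cong[OF Av, of "\<lambda>w. vec_index w 1"] v
    by (simp add: scalar_prod_def numeral_2_eq_2 algebra_simps)
  ultimately have "vec_index v 1 = b / (s + b)" "vec_index v 0 = a * vec_index v 1 / (s + a)"
    using a b s by (simp_all add: nonzero_eq_divide_eq mult.commute)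
  then have "vec_index v 0 = a * b / ((s + a) * (s + b))" by simp
  then show ?thesis
    using v unfolding ph_transform_def B(1) option.sel v_def[symmetric]
    by simp
qed

lemma PH_hypoexp:
  assumes "prob_space \<mu>" "sets \<mu> = sets borel" "AE w in \<mu>. 0 \<le> w"
    and a: "0 < a" and b: "0 < b"
    and transform: "\<And>s. 0 \<le> s \<Longrightarrow> (\<integral>w. exp (- s * w) \<partial>\<mu>) = a * b / ((s + a) * (s + b))"
  shows "\<mu> \<in> PH"
proof -
  have "scalar_prod (unit_vec 2 0) (ones 2) \<le> 1" by simp
  then show ?thesis
    unfolding PH_def using assms transient_subgenerator_hypoexp[OF a b]
    by (auto intro!: exI[of _ "2::nat"] exI[of _ "hypoexp_generator a b"]
        exI[of _ "unit_vec 2 0 :: real Matrix.vec"] simp: ph_transform_hypoexp)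
qed

section \<open>Linear functionals of the Wishart matrix\<close>

text \<open>Multiplying the quadratic form by its first coefficient and completing the square exhibits
  it as a sum of squares with positive weights.\<close>

lemma quadratic_form_nonneg_2:
  fixes A :: "real^2^2"
  assumes sym: "A $ 2 $ 1 = A $ 1 $ 2" and p: "0 < A $ 1 $ 1" and det: "0 < Determinants.det A"
  shows "0 \<le> g \<bullet> (A *v g)"
proof -
  have "A $ 1 $ 1 * (g \<bullet> (A *v g)) =
      (A $ 1 $ 1 * g $ 1 + A $ 1 $ 2 * g $ 2)\<^sup>2 + Determinants.det A * (g $ 2)\<^sup>2"
    by (simp add: inner_vec_def matrix_vector_mult_def sum_2 det_2 sym algebra_simps power2_eq_square)
  also have "\<dots> \<ge> 0" using det by simp
  finally show ?thesis using p by (simp add: zero_le_mult_iff)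
qed

text \<open>The numbers \<open>l\<close> and \<open>m\<close> are the eigenvalues of \<open>A\<close>. They are real because the discriminant
  of the characteristic polynomial is \<open>(p - r)\<^sup>2 + 4 q\<^sup>2\<close>, and positive because their sum \<open>p + r\<close> and
  their product \<open>det A\<close> are.\<close>

lemma det_resolvent_factorization:
  fixes A :: "real^2^2"
  assumes sym: "A $ 2 $ 1 = A $ 1 $ 2" and p: "0 < A $ 1 $ 1" and det: "0 < Determinants.det A"
  obtains l m where "0 < l" "0 < m"
    "\<And>s. Determinants.det (Finite_Cartesian_Product.mat 1 + s *\<^sub>R A) = (1 + s * l) * (1 + s * m)"
proof -
  define p q r where "p = A $ 1 $ 1" and "q = A $ 1 $ 2" and "r = A $ 2 $ 2"
  define d where "d = sqrt ((p - r)\<^sup>2 + 4 * q\<^sup>2)"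
  define l m where "l = (p + r + d) / 2" and "m = (p + r - d) / 2"
  have p0: "0 < p" and pr: "0 < p * r - q\<^sup>2"
    using p det by (auto simp: det_2 p_def q_def r_def sym power2_eq_square)
  have "0 < p * r" using pr zero_le_power2[of q] by linarith
  then have r0: "0 < r" using p0 by (simp add: zero_less_mult_iff)
  have d: "d\<^sup>2 = (p - r)\<^sup>2 + 4 * q\<^sup>2" "0 \<le> d" unfolding d_def by simp_all
  have sum: "l + m = p + r" by (simp add: l_def m_def field_simps)
  have "l * m = ((p + r)\<^sup>2 - d\<^sup>2) / 4" by (simp add: l_def m_def field_simps power2_eq_square)
  then have prod: "l * m = p * r - q\<^sup>2" unfolding d by (simp add: field_simps power2_eq_square)
  have l0: "0 < l" using p0 r0 d by (simp add: l_def)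
  then have m0: "0 < m" using pr unfolding prod[symmetric] by (simp add: zero_less_mult_iff)
  have "Determinants.det (Finite_Cartesian_Product.mat 1 + s *\<^sub>R A) = (1 + s * l) * (1 + s * m)" for s
  proof -
    have "Determinants.det (Finite_Cartesian_Product.mat 1 + s *\<^sub>R A) =
        1 + s * (p + r) + s\<^sup>2 * (p * r - q\<^sup>2)"
      by (simp add: det_2 Finite_Cartesian_Product.mat_def sym p_def q_def r_def
          algebra_simps power2_eq_square)
    also have "\<dots> = (1 + s * l) * (1 + s * m)"
      unfolding sum[symmetric] prod[symmetric] by (simp add: algebra_simps power2_eq_square)
    finally show ?thesis .
  qed
  with l0 m0 show thesis by (rule that)
qed

lemma trace_wishart_2_half_PH:
  fixes A :: "real^2^2"
  assumes sym: "A $ 2 $ 1 = A $ 1 $ 2" and p: "0 < A $ 1 $ 1" and det: "0 < Determinants.det A"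
  shows "distr wishart_2_half borel (\<lambda>z. trace (A ** z)) \<in> PH"
proof -
  interpret W: prob_space wishart_2_half by (rule prob_space_wishart_2_half)
  obtain l m where l: "0 < l" and m: "0 < m"
    and lm: "\<And>s. Determinants.det (Finite_Cartesian_Product.mat 1 + s *\<^sub>R A) = (1 + s * l) * (1 + s * m)"
    using det_resolvent_factorization[OF sym p det] by metis
  show ?thesis
  proof (rule PH_hypoexp)
    show "prob_space (distr wishart_2_half borel (\<lambda>z. trace (A ** z)))"
      by (rule W.prob_space_distr) measurable
    show "AE w in distr wishart_2_half borel (\<lambda>z. trace (A ** z)). 0 \<le> w"
      by (subst AE_distr_iff)
         (auto intro!: AE_wishart_2_half_trace_nonneg quadratic_form_nonneg_2[OF sym p det])
    show "0 < 1 / l" "0 < 1 / m" using l m by simp_all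
    fix s :: real assume s: "0 \<le> s"
    have D: "0 < (1 + s * l) * (1 + s * m)"
      using l m s by (intro mult_pos_pos add_pos_nonneg) auto
    have scale: "trace ((s *\<^sub>R A) ** z) = s * trace (A ** z)" for z
      by (simp add: trace_def matrix_matrix_mult_def sum_distrib_left mult_ac)
    have "(\<integral>w. exp (- s * w) \<partial>distr wishart_2_half borel (\<lambda>z. trace (A ** z))) =
        (\<integral>z. exp (- trace ((s *\<^sub>R A) ** z)) \<partial>wishart_2_half)"
      by (subst integral_distr) (auto simp: scale)
    also have "\<dots> = 1 / ((1 + s * l) * (1 + s * m))"
      unfolding lm[symmetric]
    proof (rule wishart_2_half_transform)
      show "0 < 1 + (s *\<^sub>R A) $ 1 $ 1" using s p by (simp add: add_pos_nonneg)
    qed (use sym D lm in auto)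
    also have "\<dots> = 1 / l * (1 / m) / ((s + 1 / l) * (s + 1 / m))"
      using l m by (simp add: field_simps)
    finally show "(\<integral>w. exp (- s * w) \<partial>distr wishart_2_half borel (\<lambda>z. trace (A ** z))) =
        1 / l * (1 / m) / ((s + 1 / l) * (s + 1 / m))" .
  qed simp
qed

theorem theorem4p6:
  fixes M :: "'a measure" and Z :: "'a \<Rightarrow> real^2^2" and X :: "'a \<Rightarrow> real^3"
    and H1 H2 H3 :: "real^2^2"
  assumes "prob_space M"
    and "Z \<in> borel_measurable M" and "distr M borel Z = wishart_2_half"
    and "H1 = vector [vector [1, 0], vector [0, 1]]"
    and "H2 = vector [vector [2, 1], vector [1, 2]]"
    and "H3 = vector [vector [3, 0], vector [0, 1]]"
    and "\<And>\<omega>. X \<omega> = vector [trace (H1 ** Z \<omega>), trace (H2 ** Z \<omega>), trace (H3 ** Z \<omega>)]"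
  shows "distr M borel X \<in> MVPH"
proof -
  interpret W: prob_space wishart_2_half by (rule prob_space_wishart_2_half)
  define h :: "real^2^2 \<Rightarrow> real^3"
    where "h z = vector [trace (H1 ** z), trace (H2 ** z), trace (H3 ** z)]" for z
  have h [measurable]: "h \<in> borel \<rightarrow>\<^sub>M borel"
    unfolding borel_measurable_euclidean_space[where 'c = "real^3"]
    by (auto simp: Basis_vec_def inner_axis h_def forall_3)
  have X: "distr M borel X = distr wishart_2_half borel h"
  proof -
    have "X = h \<circ> Z" using assms(7) by (simp add: h_def fun_eq_iff)
    then have "distr M borel X = distr (distr M borel Z) borel h"
      using distr_distr[OF h assms(2)] by simp
    then show ?thesis by (simp only: assms(3))
  qed
  note H = assms(4-6)
  have nonneg: "AE z in wishart_2_half. 0 \<le> trace (H1 ** z)"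
      "AE z in wishart_2_half. 0 \<le> trace (H2 ** z)"
      "AE z in wishart_2_half. 0 \<le> trace (H3 ** z)"
    by (intro AE_wishart_2_half_trace_nonneg quadratic_form_nonneg_2; simp add: H det_2)+
  have "AE y in distr wishart_2_half borel h. \<forall>j. 0 \<le> y $ j"
    using nonneg by (subst AE_distr_iff) (auto simp: h_def forall_3)
  moreover have "distr (distr wishart_2_half borel h) borel (\<lambda>y. a \<bullet> y) \<in> PH"
    if a: "\<And>j. 0 \<le> a $ j" "a \<noteq> 0" for a
  proof -
    define A where "A = a $ 1 *\<^sub>R H1 + a $ 2 *\<^sub>R H2 + a $ 3 *\<^sub>R H3"
    have aX: "a \<bullet> h z = trace (A ** z)" for z
      by (simp add: A_def h_def inner_vec_def sum_3 sum_2 trace_def matrix_matrix_mult_def algebra_simps)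
    have entries: "A $ 1 $ 1 = a $ 1 + 2 * a $ 2 + 3 * a $ 3" "A $ 2 $ 2 = a $ 1 + 2 * a $ 2 + a $ 3"
        "A $ 1 $ 2 = a $ 2" "A $ 2 $ 1 = a $ 2"
      by (simp_all add: A_def H)
    obtain j where "0 < a $ j"
      using a by (metis Finite_Cartesian_Product.vec_eq_iff order_le_less zero_index)
    then have pos: "0 < a $ 1 + a $ 2 + a $ 3"
      using a(1)[of 1] a(1)[of 2] a(1)[of 3] exhaust_3[of j] by auto
    have p: "0 < A $ 1 $ 1"
      using pos a(1)[of 1] a(1)[of 2] a(1)[of 3] unfolding entries by linarith
    \<comment> \<open>Both diagonal entries of \<open>A\<close> strictly exceed the off-diagonal entry \<open>a\<^sub>2 \<ge> 0\<close>.\<close>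
    have "a $ 2 * a $ 2 < (a $ 1 + 2 * a $ 2 + 3 * a $ 3) * (a $ 1 + 2 * a $ 2 + a $ 3)"
      using pos a(1)[of 1] a(1)[of 2] a(1)[of 3] by (intro mult_strict_mono') auto
    then have "0 < Determinants.det A" by (simp add: det_2 entries)
    then have "distr wishart_2_half borel (\<lambda>z. trace (A ** z)) \<in> PH"
      using p by (intro trace_wishart_2_half_PH) (simp_all add: entries)
    then show ?thesis
      by (simp add: distr_distr comp_def aX)
  qed
  ultimately show ?thesis
    unfolding X MVPH_def using W.prob_space_distr[of h borel] by (auto simp: measurable_cong_sets[OF sets_wishart_2_half])
qed

end
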